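(* Let $k\ge 2$ and let $a_1,\ldots,a_k$ be relatively prime positive integers (i.e. $\gcd(a_1,\ldots,a_k)=1$). Let $d=\gcd(a_2,\ldots,a_k)$ and let $j\ge 0$ be an integer. Then either $$g_j(a_1,a_2,\ldots,a_k)=d\cdot g_j\!\left(a_1,\frac{a_2}{d},\ldots,\frac{a_k}{d}\right)+(d-1)a_1,$$ or $$g_j(a_1,a_2,\ldots,a_k)=g_j\!\left(a_1,\frac{a_2}{d},\ldots,\frac{a_k}{d}\right)=0.$$
   Context: A representation of an integer $M$ by a $k$-tuple $(b_1,\ldots,b_k)$ of positive integers is a solution $(x_1,\ldots,x_k)\in\mathbb{Z}_{\ge 0}^k$ of $M=\sum_{i=1}^k b_ix_i$. For relatively prime positive integers $b_1,\ldots,b_k$ and an integer $j\ge 0$, the $j$-Frobenius number $g_j(b_1,\ldots,b_k)$ is the greatest integer $M$ having exactly $j$ representations by $(b_1,\ldots,b_k)$, if such a positive integer exists, and $g_j(b_1,\ldots,b_k)=0$ otherwise.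
   Formalization: For j=0 the case a_1>1, d>1 with d equal to some a_i (i≥2) is excluded: there the claim always fails, e.g. g_0(3,2)=1 and g_0(3,1)=0, while the formula gives 3. *)

theory Defs
  imports Main
begin

definition representations :: "nat list \<Rightarrow> int \<Rightarrow> nat list set" where
  "representations b M =
     {x. length x = length b \<and> M = (\<Sum>i<length b. int (b ! i) * int (x ! i))}"

text \<open>
  If all entries of \<open>b\<close> are positive then \<open>representations b M\<close> is finite, so
  \<open>card\<close> counts it. If moreover \<open>b\<close> has at least two entries and greatest common
  divisor 1, the number of representations tends to infinity with \<open>M\<close>, so the
  greatest integer below exists whenever its guard holds.
\<close>

definition frobenius_number :: "nat \<Rightarrow> nat list \<Rightarrow> int" where
  "frobenius_number j b =
     (if \<exists>M>0. card (representations b M) = j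
      then GREATEST M. card (representations b M) = j
      else 0)"

text \<open>
  With the value 0 (rather than -1) when every positive integer is representable, the
  reduction formula for the pair (3, 2), where d = 2, fails at \<open>j = 0\<close>: it would
  give 2 * 0 + 3 = 3 instead of 1. More generally, it fails for \<open>j = 0\<close> exactly when
  \<open>a\<^sub>1 > 1\<close>, \<open>d > 1\<close> and some \<open>a\<^sub>i\<close> with \<open>i \<ge> 2\<close> equals \<open>d\<close>.
\<close>

lemma representations_pair:
  "representations [p, q] M =
     (\<lambda>(u, v). [u, v]) ` {(u, v). M = int p * int u + int q * int v}"
proof -
  have "x \<in> representations [p, q] M \<longleftrightarrow>
      (\<exists>u v. x = [u, v] \<and> M = int p * int u + int q * int v)" for x
    by (auto simp: representations_def length_Suc_conv numeral_2_eq_2)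
  then show ?thesis by auto
qed

lemma finite_representations_pair:
  assumes "p > 0" "q > 0"
  shows "finite (representations [p, q] M)"
proof -
  have "{(u, v). M = int p * int u + int q * int v} \<subseteq> {..nat M} \<times> {..nat M}"
  proof clarify
    fix u v assume M: "M = int p * int u + int q * int v"
    have "int u \<le> int p * int u" "int v \<le> int q * int v"
      using assms by (simp_all add: mult_le_cancel_right1)
    moreover have "0 \<le> int p * int u" "0 \<le> int q * int v" by simp_all
    ultimately have "int u \<le> M" "int v \<le> M" using M by linarith+
    then show "u \<in> {..nat (int p * int u + int q * int v)} \<and>
        v \<in> {..nat (int p * int u + int q * int v)}"
      using M by auto
  qed
  then show ?thesis
    unfolding representations_pair using finite_subset by blast
qed

lemma card_representations_pair_eq_0:
  assumes "p > 0" "q > 0"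
  shows "card (representations [p, q] M) = 0 \<longleftrightarrow>
    (\<nexists>u v :: nat. M = int p * int u + int q * int v)"
  using finite_representations_pair[OF assms] by (auto simp: representations_pair)

lemma frobenius_number_0_3_1: "frobenius_number 0 [3, 1] = 0"
proof -
  have "\<exists>u v :: nat. M = int 3 * int u + int 1 * int v" if "M > 0" for M
    using that by (intro exI[of _ 0] exI[of _ "nat M"]) simp
  then show ?thesis
    unfolding frobenius_number_def by (subst card_representations_pair_eq_0) auto
qed

lemma frobenius_number_0_3_2: "frobenius_number 0 [3, 2] = 1"
proof -
  have one: "\<nexists>u v :: nat. (1::int) = int 3 * int u + int 2 * int v"
    by presburger
  have big: "\<exists>u v :: nat. M = int 3 * int u + int 2 * int v" if "M > 1" for M
  proof (cases "even M")
    case True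
    with that show ?thesis by (intro exI[of _ 0] exI[of _ "nat (M div 2)"]) auto
  next
    case False
    with that have "M = 3 + 2 * ((M - 3) div 2)" "(M - 3) div 2 \<ge> 0" by presburger+
    then show ?thesis by (intro exI[of _ 1] exI[of _ "nat ((M - 3) div 2)"]) auto
  qed
  have P: "card (representations [3, 2] M) = 0 \<longleftrightarrow>
      (\<nexists>u v :: nat. M = int 3 * int u + int 2 * int v)" for M
    by (rule card_representations_pair_eq_0) simp_all
  have "(GREATEST M. card (representations [3, 2] M) = 0) = 1"
    unfolding P
  proof (rule Greatest_equality)
    show "y \<le> 1" if "\<nexists>u v :: nat. y = int 3 * int u + int 2 * int v" for y
      using that big[of y] by (meson not_less)
  qed (rule one)
  moreover have "\<exists>M>0. card (representations [3, 2] M) = 0"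
    unfolding P using one by (intro exI[of _ 1]) auto
  ultimately show ?thesis
    unfolding frobenius_number_def by simp
qed

end

theory Submission
  imports Defs
begin

text \<open>
  Write \<open>M = d N + a\<^sub>1 t\<close> with \<open>0 \<le> t < d\<close>; as \<open>d\<close> is coprime to \<open>a\<^sub>1\<close>, this is possible for
  every integer \<open>M\<close> in a unique way. In every representation of \<open>M\<close> the first coordinate
  is congruent to \<open>t\<close> modulo \<open>d\<close>, so the representations of \<open>M\<close> by \<open>(a\<^sub>1, a\<^sub>2, \<dots>)\<close>
  correspond to those of \<open>N\<close> by \<open>(a\<^sub>1, a\<^sub>2/d, \<dots>)\<close>. Hence, if \<open>G\<close> is the greatest integer,
  possibly negative, with \<open>j\<close> representations by the reduced tuple, then \<open>d G + (d - 1) a\<^sub>1\<close>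
  is the greatest one for the original tuple. The greatest integer exists unless no integer has
  exactly \<open>j\<close> representations: \<open>(a\<^sub>2/d, \<dots>)\<close> has greatest common divisor 1 and so represents
  all large integers, and varying the first coordinate gives more than \<open>j\<close> representations.
  Truncating a negative \<open>G\<close> to 0 matters only for \<open>j = 0\<close> and \<open>G = -1\<close>; then 1 is an entry of the
  reduced tuple, which leaves only \<open>a\<^sub>1 = 1\<close> or \<open>d = 1\<close>, and both Frobenius numbers are 0.
\<close>

section \<open>Representations: recursion, finiteness, scaling\<close>

lemma representations_Nil: "representations [] M = (if M = 0 then {[]} else {})"
  by (auto simp: representations_def)

lemma Cons_in_representations_Cons:
  "x # xs \<in> representations (a # b) M \<longleftrightarrow> xs \<in> representations b (M - int a * int x)"
  by (auto simp: representations_def sum.lessThan_Suc_shift simp del: sum.lessThan_Suc)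

lemma representations_ConsE:
  assumes "y \<in> representations (a # b) M"
  obtains x xs where "y = x # xs" "xs \<in> representations b (M - int a * int x)"
proof (cases y)
  case Nil
  with assms show ?thesis by (simp add: representations_def)
next
  case (Cons x xs)
  with assms that show ?thesis by (simp add: Cons_in_representations_Cons)
qed

lemma representations_nonneg: "x \<in> representations b M \<Longrightarrow> M \<ge> 0"
  by (auto simp: representations_def intro!: sum_nonneg)

lemma representations_neg: "M < 0 \<Longrightarrow> representations b M = {}"
  using representations_nonneg[of _ b M] by fastforce

text \<open>The first summand \<open>a * x\<close> is 0 or 1: if 0, the remaining entries still
  represent 1; if 1, then \<open>a = 1\<close>.\<close>

lemma representations_1:
  assumes "y \<in> representations b 1"
  shows "1 \<in> set b"
  using assms
proof (induction b arbitrary: y)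
  case Nil
  then show ?case by (simp add: representations_Nil)
next
  case (Cons a b)
  from Cons.prems obtain x xs where xs: "xs \<in> representations b (1 - int a * int x)"
    by (rule representations_ConsE)
  then have "int (a * x) \<le> 1"
    using representations_nonneg by fastforce
  then have "a * x = 0 \<or> a * x = 1" by linarith
  then show ?case
  proof
    assume "a * x = 0"
    then have "int a * int x = 0" by auto
    with xs Cons.IH show ?thesis by simp
  qed simp
qed

lemma representations_dvd:
  assumes "x \<in> representations b M" "\<forall>a\<in>set b. d dvd a"
  shows "int d dvd M"
  using assms by (auto simp: representations_def intro!: dvd_sum)

lemma finite_representations:
  assumes "\<forall>a\<in>set b. a > 0"
  shows "finite (representations b M)"
  using assms
proof (induction b arbitrary: M)
  case Nil
  then show ?case by (simp add: representations_Nil)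
next
  case (Cons a b)
  have "representations (a # b) M \<subseteq>
      (\<Union>x\<in>{..nat M}. (#) x ` representations b (M - int a * int x))"
  proof
    fix y assume "y \<in> representations (a # b) M"
    then obtain x xs where y: "y = x # xs" and xs: "xs \<in> representations b (M - int a * int x)"
      by (rule representations_ConsE)
    have "M - int a * int x \<ge> 0"
      using xs by (rule representations_nonneg)
    moreover have "int x \<le> int a * int x"
      using Cons.prems by (simp add: mult_le_cancel_right1)
    ultimately have "x \<le> nat M" by linarith
    with y xs show "y \<in> (\<Union>x\<in>{..nat M}. (#) x ` representations b (M - int a * int x))"
      by auto
  qed
  moreover have "finite (representations b N)" for N
    using Cons by simp
  ultimately show ?case by (meson finite_UN_I finite_atMost finite_imageI finite_subset)
qed

lemma representations_scale:
  assumes "d > 0" "\<forall>a\<in>set b. d dvd a"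
  shows "representations b (int d * K) = representations (map (\<lambda>a. a div d) b) K"
proof -
  have "(\<Sum>i<length b. int (b ! i) * int (x ! i)) =
      int d * (\<Sum>i<length b. int (b ! i div d) * int (x ! i))" for x :: "nat list"
    unfolding sum_distrib_left
  proof (rule sum.cong)
    fix i assume "i \<in> {..<length b}"
    then have "b ! i = d * (b ! i div d)" using assms by simp
    then have "int (b ! i) = int d * int (b ! i div d)" by (metis of_nat_mult)
    then show "int (b ! i) * int (x ! i) = int d * (int (b ! i div d) * int (x ! i))"
      by simp
  qed simp
  then show ?thesis
    using assms(1) by (auto simp: representations_def)
qed

section \<open>Representability of large integers\<close>

text \<open>Multiplying a Bezout identity for \<open>a\<close> and \<open>d\<close> by
  \<open>M / gcd a d\<close> gives \<open>u * q\<close> as a coefficient of \<open>a\<close>;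
  reducing it modulo \<open>d\<close> changes the remainder term only by a multiple of
  \<open>d\<close>.\<close>

lemma exists_residue:
  fixes a d :: nat and M :: int
  assumes "d > 0" "int (gcd a d) dvd M"
  shows "\<exists>t<d. int d dvd M - int a * int t"
proof -
  obtain q where q: "M = int (gcd a d) * q" using assms(2) by (elim dvdE)
  obtain u v where uv: "u * int a + v * int d = gcd (int a) (int d)"
    using bezout_int by blast
  define t where "t = nat ((u * q) mod int d)"
  have t: "int t = (u * q) mod int d" using assms(1) by (simp add: t_def)
  have eq: "int t = u * q - int d * (u * q div int d)"
    unfolding t by (simp add: minus_mult_div_eq_mod)
  have "M = (u * int a + v * int d) * q" using q uv by simp
  then have "M - int a * int t = int d * (v * q + int a * (u * q div int d))"
    unfolding eq by (simp add: algebra_simps)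
  moreover have "t < d" using t assms(1) by (metis of_nat_less_iff of_nat_0_less_iff pos_mod_bound)
  ultimately show ?thesis by (intro exI[of _ t]) simp
qed

text \<open>Induction on the tuple: with \<open>g\<close> the gcd of the tail, some first coordinate
  \<open>t < g\<close> makes the rest divisible by \<open>g\<close>. Since \<open>t\<close> stays
  below \<open>g\<close>, raising the threshold by \<open>a * g\<close> keeps the rest large
  enough.\<close>

lemma eventually_representable:
  assumes "b \<noteq> []" "\<forall>a\<in>set b. a > 0"
  shows "\<exists>N\<^sub>0\<ge>0. \<forall>N\<ge>N\<^sub>0. int (Gcd (set b)) dvd N \<longrightarrow> representations b N \<noteq> {}"
  using assms
proof (induction b rule: list_nonempty_induct)
  case (single a)
  have "representations [a] N \<noteq> {}" if "N \<ge> 0" "int a dvd N" for N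
  proof -
    obtain q where q: "N = int a * q" using \<open>int a dvd N\<close> by (elim dvdE)
    have "q \<ge> 0" using \<open>N \<ge> 0\<close> q single by (simp add: zero_le_mult_iff)
    then have "[nat q] \<in> representations [a] N"
      using q by (simp add: Cons_in_representations_Cons representations_Nil)
    then show ?thesis by blast
  qed
  then show ?case by auto
next
  case (cons a b)
  define g where "g = Gcd (set b)"
  obtain N\<^sub>0 where N\<^sub>0: "N\<^sub>0 \<ge> 0" "\<And>N. N \<ge> N\<^sub>0 \<Longrightarrow> int g dvd N \<Longrightarrow> representations b N \<noteq> {}"
    using cons unfolding g_def by auto
  have "hd b \<in> set b" "hd b > 0" using cons by auto
  then have "g > 0" unfolding g_def by (metis Gcd_dvd dvd_0_left not_gr0)
  have "representations (a # b) N \<noteq> {}"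
    if N: "N \<ge> N\<^sub>0 + int a * int g" "int (Gcd (set (a # b))) dvd N" for N
  proof -
    have "int (gcd a g) dvd N" using N by (simp add: g_def)
    with \<open>g > 0\<close> obtain t where t: "t < g" "int g dvd N - int a * int t"
      using exists_residue by blast
    have "int a * int t \<le> int a * int g" using t by (intro mult_left_mono) auto
    then obtain x where "x \<in> representations b (N - int a * int t)"
      using N\<^sub>0(2)[OF _ t(2)] N by fastforce
    then have "t # x \<in> representations (a # b) N" by (simp add: Cons_in_representations_Cons)
    then show ?thesis by blast
  qed
  then show ?case
    using N\<^sub>0(1) by (intro exI[of _ "N\<^sub>0 + int a * int g"]) simp
qed

text \<open>For large \<open>N\<close> each of the \<open>j + 1\<close> first coordinates
  \<open>0, ..., j\<close> extends to a representation. This bounds the integers with exactly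
  \<open>j\<close> representations from above.\<close>

lemma eventually_many_representations:
  assumes "b \<noteq> []" "\<forall>c\<in>set (a # b). c > 0" "Gcd (set b) = 1"
  shows "\<exists>N\<^sub>1. \<forall>N\<ge>N\<^sub>1. card (representations (a # b) N) > j"
proof -
  obtain N\<^sub>0 where N\<^sub>0: "\<And>N. N \<ge> N\<^sub>0 \<Longrightarrow> representations b N \<noteq> {}"
    using eventually_representable[of b] assms by auto
  have "card (representations (a # b) N) > j" if N: "N \<ge> N\<^sub>0 + int a * int j" for N
  proof -
    have "representations b (N - int a * int i) \<noteq> {}" if "i \<le> j" for i
    proof (rule N\<^sub>0)
      have "int a * int i \<le> int a * int j" using that by (intro mult_left_mono) auto
      then show "N - int a * int i \<ge> N\<^sub>0"
        using N by linarith
    qed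
    then have "\<forall>i. \<exists>x. i \<le> j \<longrightarrow> x \<in> representations b (N - int a * int i)"
      by blast
    then obtain f where f: "\<And>i. i \<le> j \<Longrightarrow> f i \<in> representations b (N - int a * int i)"
      unfolding choice_iff by blast
    have "(\<lambda>i. i # f i) ` {..j} \<subseteq> representations (a # b) N"
      using f by (auto simp: Cons_in_representations_Cons)
    then have "card ((\<lambda>i. i # f i) ` {..j}) \<le> card (representations (a # b) N)"
      by (intro card_mono finite_representations assms)
    moreover have "inj_on (\<lambda>i. i # f i) {..j}" by (auto intro: inj_onI)
    ultimately show ?thesis by (simp add: card_image)
  qed
  then show ?thesis by blast
qed

section \<open>Division of the tail by \<open>d\<close>\<close>

text \<open>The bijection replaces the first coordinate \<open>x\<close> by \<open>t + d * x\<close>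
  and keeps the others.\<close>

lemma card_representations_reduce:
  assumes "t < d" "coprime a d" "\<forall>c\<in>set b. d dvd c"
  shows "card (representations (a # b) (int d * N + int a * int t)) =
    card (representations (a # map (\<lambda>c. c div d) b) N)" (is "card ?R = card ?S")
proof -
  define f where "f = (\<lambda>x. (t + d * hd x) # tl x)"
  have "d > 0" using assms(1) by simp
  have shift: "int d * N + int a * int t - int a * int (t + d * x) = int d * (N - int a * int x)"
    for x by (simp add: algebra_simps)
  have f_Cons: "(t + d * x) # xs \<in> ?R \<longleftrightarrow> x # xs \<in> ?S" for x xs
    unfolding Cons_in_representations_Cons shift
    using representations_scale[OF \<open>d > 0\<close> assms(3)] by simp
  have "inj_on f ?S"
  proof (rule inj_onI)
    fix y z assume "y \<in> ?S" "z \<in> ?S" and eq: "f y = f z"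
    then obtain x xs x' xs' where "y = x # xs" "z = x' # xs'"
      by (metis representations_ConsE)
    with eq \<open>d > 0\<close> show "y = z" by (simp add: f_def)
  qed
  moreover have "f ` ?S = ?R"
  proof (intro equalityI subsetI)
    fix y assume "y \<in> f ` ?S"
    then obtain z where z: "z \<in> ?S" "y = f z" by blast
    from z(1) obtain x xs where "z = x # xs" by (rule representations_ConsE)
    with z f_Cons show "y \<in> ?R" by (simp add: f_def)
  next
    fix y assume y: "y \<in> ?R"
    then obtain x xs where y_eq: "y = x # xs"
      and xs: "xs \<in> representations b (int d * N + int a * int t - int a * int x)"
      by (rule representations_ConsE)
    \<comment> \<open>Surjectivity: \<open>d\<close> divides the contribution of \<open>b\<close>,
      so \<open>d\<close> divides \<open>a * (t - x)\<close>; coprimality and \<open>t < d\<close>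
      make \<open>t\<close> the remainder of \<open>x\<close> modulo \<open>d\<close>.\<close>
    have "int d dvd int d * N + int a * (int t - int x)"
      using representations_dvd[OF xs assms(3)] by (simp add: algebra_simps)
    then have "int d dvd int a * (int t - int x)"
      by (metis dvd_add_times_triv_left_iff mult.commute)
    then have "int d dvd int t - int x"
      using assms(2) by (metis coprime_commute coprime_dvd_mult_right_iff coprime_int_iff)
    then have "int t mod int d = int x mod int d" by (simp add: mod_eq_dvd_iff)
    then have "x mod d = t"
      using assms(1) by (metis mod_less of_nat_eq_iff zmod_int)
    then have x: "x = t + d * (x div d)" by (metis mod_mult_div_eq)
    have "(x div d) # xs \<in> ?S"
      using y y_eq x f_Cons by metis
    moreover have "y = f ((x div d) # xs)"
      using y_eq x by (simp add: f_def)
    ultimately show "y \<in> f ` ?S" by blast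
  qed
  ultimately show ?thesis by (metis card_image)
qed

section \<open>Greatest integers and truncation at 0\<close>

text \<open>\<open>P\<close> may hold at infinitely many negative integers, as for
  \<open>j = 0\<close>, so the maximum is taken over the finite part above the witness
  \<open>m\<close>.\<close>

lemma exists_greatest_int:
  fixes P :: "int \<Rightarrow> bool"
  assumes "P m" "\<And>n. P n \<Longrightarrow> n \<le> B"
  obtains G where "P G" "\<And>n. P n \<Longrightarrow> n \<le> G"
proof -
  have fin: "finite {n. P n \<and> n \<ge> m}"
    by (rule finite_subset[of _ "{m..B}"]) (use assms(2) in auto)
  have ne: "{n. P n \<and> n \<ge> m} \<noteq> {}" using assms(1) by auto
  have "P (Max {n. P n \<and> n \<ge> m})" using Max_in[OF fin ne] by blast
  moreover have "n \<le> Max {n. P n \<and> n \<ge> m}" if "P n" for n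
  proof (cases "n \<ge> m")
    case True
    with that fin show ?thesis by simp
  next
    case False
    moreover have "m \<le> Max {n. P n \<and> n \<ge> m}" using fin assms(1) by simp
    ultimately show ?thesis by linarith
  qed
  ultimately show ?thesis using that by blast
qed

text \<open>\<open>GREATEST\<close> ranges over all integers, and the guard \<open>M > 0\<close> in
  the definition holds exactly when \<open>G > 0\<close>.\<close>

lemma frobenius_number_eq_max_0:
  assumes "card (representations b G) = j"
    and "\<And>M. card (representations b M) = j \<Longrightarrow> M \<le> G"
  shows "frobenius_number j b = max 0 G"
proof -
  have "(GREATEST M. card (representations b M) = j) = G"
    using assms by (intro Greatest_equality)
  then show ?thesis
    unfolding frobenius_number_def using assms by force
qed

section \<open>The reduction formula\<close>

theorem theorem1:
  fixes a\<^sub>1 d j :: nat and as :: "nat list"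
  assumes "length (a\<^sub>1 # as) \<ge> 2"
    and "\<forall>a \<in> set (a\<^sub>1 # as). a > 0"
    and "Gcd (set (a\<^sub>1 # as)) = 1"
    and "d = Gcd (set as)"
    and "j = 0 \<Longrightarrow> a\<^sub>1 = 1 \<or> d = 1 \<or> d \<notin> set as"
  shows "frobenius_number j (a\<^sub>1 # as) =
           int d * frobenius_number j (a\<^sub>1 # map (\<lambda>a. a div d) as) + (int d - 1) * int a\<^sub>1
       \<or> frobenius_number j (a\<^sub>1 # as) = 0
         \<and> frobenius_number j (a\<^sub>1 # map (\<lambda>a. a div d) as) = 0"
proof -
  define bs where "bs = map (\<lambda>a. a div d) as"
  define r where "r = (\<lambda>M. card (representations (a\<^sub>1 # as) M))"
  define s where "s = (\<lambda>M. card (representations (a\<^sub>1 # bs) M))"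
  have "as \<noteq> []" using assms(1) by auto
  have dvd: "\<forall>a\<in>set as. d dvd a" using assms(4) by (simp add: Gcd_dvd)
  have "hd as \<in> set as" using \<open>as \<noteq> []\<close> by simp
  then have "d > 0" using dvd assms(2) by (metis dvd_0_left_iff list.set_intros(2) not_gr0)
  have cop: "coprime a\<^sub>1 d" using assms(3,4) by (simp add: coprime_iff_gcd_eq_1)
  have bs_pos: "\<forall>c\<in>set (a\<^sub>1 # bs). c > 0"
    using assms(2) dvd \<open>d > 0\<close> by (auto simp: bs_def div_greater_zero_iff intro: dvd_imp_le)
  \<comment> \<open>A common divisor of \<open>bs\<close>, multiplied by \<open>d\<close>, divides
    every entry of \<open>as\<close> and hence \<open>d\<close>; so the gcd of \<open>bs\<close> is
    1.\<close>
  have "d * Gcd (set bs) dvd c" if "c \<in> set as" for c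
  proof -
    have "Gcd (set bs) dvd c div d" using that by (intro Gcd_dvd) (simp add: bs_def)
    then have "d * Gcd (set bs) dvd d * (c div d)" by (rule mult_dvd_mono[OF dvd_refl])
    then show ?thesis using dvd that by simp
  qed
  then have "d * Gcd (set bs) dvd d" using assms(4) by (metis Gcd_greatest)
  then have Gcd_bs: "Gcd (set bs) = 1" using \<open>d > 0\<close> by simp
  have r_s: "r (int d * N + int a\<^sub>1 * int t) = s N" if "t < d" for N t
    unfolding r_def s_def bs_def by (rule card_representations_reduce[OF that cop dvd])
  have decompose: "\<exists>N t. t < d \<and> M = int d * N + int a\<^sub>1 * int t" for M
  proof -
    obtain t where t: "t < d" "int d dvd M - int a\<^sub>1 * int t"
      using exists_residue[OF \<open>d > 0\<close>, of a\<^sub>1 M] cop by (auto simp: coprime_iff_gcd_eq_1)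
    then show ?thesis by (metis dvdE diff_add_cancel)
  qed
  show ?thesis
  proof (cases "\<exists>N. s N = j")
    case False
    \<comment> \<open>Every value of \<open>r\<close> is a value of \<open>s\<close>, so both guards
      fail and both Frobenius numbers are 0.\<close>
    then have "r M \<noteq> j" for M
      using decompose[of M] r_s by metis
    with False show ?thesis
      by (auto simp: frobenius_number_def r_def s_def bs_def)
  next
    case True
    then obtain m where m: "s m = j" by blast
    obtain N\<^sub>1 where N\<^sub>1: "\<And>N. N \<ge> N\<^sub>1 \<Longrightarrow> s N > j"
      using eventually_many_representations[OF _ bs_pos Gcd_bs] \<open>as \<noteq> []\<close>
      unfolding s_def bs_def by auto
    have "N \<le> N\<^sub>1" if "s N = j" for N
      using N\<^sub>1[of N] that by linarith
    with m obtain G where G: "s G = j" "\<And>N. s N = j \<Longrightarrow> N \<le> G"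
      using exists_greatest_int[of "\<lambda>N. s N = j"] by blast
    \<comment> \<open>The largest choices in the decomposition: \<open>N = G\<close> and
      \<open>t = d - 1\<close>.\<close>
    define H where "H = int d * G + (int d - 1) * int a\<^sub>1"
    have "r H = j"
      using r_s[of "d - 1" G] G(1) \<open>d > 0\<close> by (simp add: H_def of_nat_diff mult.commute)
    moreover have "M \<le> H" if "r M = j" for M
    proof -
      obtain N t where Nt: "t < d" "M = int d * N + int a\<^sub>1 * int t"
        using decompose by blast
      then have "N \<le> G" using G(2) r_s that by metis
      then have "int d * N \<le> int d * G" by (simp add: mult_left_mono)
      moreover have "int a\<^sub>1 * int t \<le> int a\<^sub>1 * (int d - 1)"
        using Nt(1) by (intro mult_left_mono) auto
      ultimately show ?thesis using Nt(2) by (simp add: H_def mult.commute)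
    qed
    ultimately have FH: "frobenius_number j (a\<^sub>1 # as) = max 0 H"
      unfolding r_def by (rule frobenius_number_eq_max_0)
    have FG: "frobenius_number j (a\<^sub>1 # bs) = max 0 G"
      using G unfolding s_def by (rule frobenius_number_eq_max_0)
    have d1: "(int d - 1) * int a\<^sub>1 \<ge> 0" using \<open>d > 0\<close> by simp
    show ?thesis
    proof (cases "G \<ge> 0")
      case True
      then have "H \<ge> 0" using d1 by (simp add: H_def)
      with True FH FG show ?thesis by (simp add: H_def bs_def)
    next
      case False
      then have "j = 0" using G(1) by (simp add: s_def representations_neg)
      have "s (-1) = 0" by (simp add: s_def representations_neg)
      \<comment> \<open>Negative integers have no representation, so \<open>-1\<close> also attains
        \<open>j = 0\<close> and \<open>G\<close> cannot be smaller.\<close>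
      then have "G = -1" using False G(2)[of "-1"] \<open>j = 0\<close> by linarith
      then have "s 1 \<noteq> 0" using G(2)[of 1] \<open>j = 0\<close> by auto
      then obtain y where y: "y \<in> representations (a\<^sub>1 # bs) 1"
        by (metis s_def card.empty ex_in_conv)
      \<comment> \<open>As \<open>1 > G\<close>, the reduced tuple represents 1 and so has an entry
        1: either \<open>a\<^sub>1\<close> itself or some \<open>c div d\<close> with
        \<open>c = d\<close>.\<close>
      have "a\<^sub>1 = 1 \<or> d = 1"
      proof (rule ccontr)
        assume "\<not> (a\<^sub>1 = 1 \<or> d = 1)"
        then have "d \<notin> set as" "a\<^sub>1 \<noteq> 1" using assms(5) \<open>j = 0\<close> by auto
        moreover have "c = d" if "c \<in> set as" "c div d = 1" for c
          using dvd that by (metis dvd_mult_div_cancel mult.right_neutral)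
        ultimately have "1 \<notin> set (a\<^sub>1 # bs)"
          by (force simp: bs_def)
        with y representations_1 show False by blast
      qed
      \<comment> \<open>In both cases \<open>H = -d + (d - 1) * a\<^sub>1\<close> equals
        \<open>-1\<close>, so both Frobenius numbers are truncated to 0.\<close>
      then have "H \<le> 0"
        using \<open>G = -1\<close> by (auto simp: H_def)
      with False FH FG show ?thesis by (simp add: bs_def)
    qed
  qed
qed

end
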